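(* Let $B_1$ and $B_2$ be the stationary Bratteli diagrams, with a single edge from $v_0$ to each vertex of the first level, whose incidence matrices are respectively $$F_1=\begin{pmatrix}2&0\\1&2\end{pmatrix},\qquad F_2=\begin{pmatrix}2&1&0\\0&2&0\\0&1&2\end{pmatrix},$$ and let $\varphi_1$ and $\varphi_2$ be Vershik maps acting on the path spaces $X_{B_1}$ and $X_{B_2}$. Then $\varphi_1$ and $\varphi_2$ are not orbit equivalent.
   Context: The stationary Bratteli diagram with incidence matrix $F$ (of size $N\times N$) and single edges at the top has $V_0=\{v_0\}$, $V_n=\{1,\dots,N\}$ for $n\ge1$, one edge in $E_1$ from $v_0$ to each vertex of $V_1$, and, for each $n\ge1$, $F_{vw}$ edges in $E_{n+1}$ from $w\in V_n$ to $v\in V_{n+1}$. For an edge $e$, $s(e)$ and $r(e)$ are its source and range. The path space $X_B$ is the set of infinite paths $x=(x_i)_{i\ge1}$, $x_i\in E_i$, $r(x_i)=s(x_{i+1})$, with the topology generated by cylinder sets. An ordering $\omega$ of $B$ is a choice of linear order on each set $r^{-1}(v)$, $v\ne v_0$. A path is maximal (minimal) if each of its edges $x_i$ is maximal (minimal) in $r^{-1}(r(x_i))$; $X_{\max}(\omega),X_{\min}(\omega)$ are the sets of maximal and minimal infinite paths. A Vershik map $\varphi$ (with respect to some ordering $\omega$) is a homeomorphism of $X_B$ such that $\varphi(X_{\max}(\omega))=X_{\min}(\omega)$ and, for $x\notin X_{\max}(\omega)$, $\varphi(x)=(x_1^0,\dots,x_{k-1}^0,\overline{x_k},x_{k+1},\dots)$,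 where $k=\min\{n: x_n\text{ is not maximal}\}$, $\overline{x_k}$ is the successor of $x_k$ in $r^{-1}(r(x_k))$, and $(x_1^0,\dots,x_{k-1}^0)$ is the minimal path from $v_0$ to $s(\overline{x_k})$. Two homeomorphisms $T_1$ of $X_1$ and $T_2$ of $X_2$ are orbit equivalent if there is a homeomorphism $f:X_1\to X_2$ which sends $T_1$-orbits onto $T_2$-orbits. *)

theory Defs
  imports "HOL-Analysis.Analysis"
begin

section \<open>Stationary Bratteli diagrams\<close>

text \<open>
  The index set \<open>{1,...,N}\<close> is a finite type \<open>'n\<close>. Vertices and edges carry their level, so that
  the sets $V_n$ (and likewise $E_n$) are pairwise disjoint: \<open>Vertex n v\<close> is the copy of \<open>v\<close> in
  $V_n$, and \<open>Edge n w v k\<close> is the \<open>k\<close>-th edge in $E_{n+1}$ from \<open>w\<close> in $V_n$ to \<open>v\<close> in $V_{n+1}$.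
\<close>

datatype 'n vertex = Root | Vertex nat 'n

datatype 'n edge = Top_Edge 'n | Edge nat 'n 'n nat

fun src :: "'n edge \<Rightarrow> 'n vertex" where
  "src (Top_Edge v) = Root"
| "src (Edge n w v k) = Vertex n w"

fun rng :: "'n edge \<Rightarrow> 'n vertex" where
  "rng (Top_Edge v) = Vertex 1 v"
| "rng (Edge n w v k) = Vertex (Suc n) v"

definition vertices :: "nat \<Rightarrow> 'n vertex set" where
  "vertices n = (if n = 0 then {Root} else range (Vertex n))"

text \<open>\<open>edges F n\<close> is $E_n$; there is no level $E_0$.\<close>

fun edges :: "nat^'n^'n \<Rightarrow> nat \<Rightarrow> 'n edge set" where
  "edges F 0 = {}"
| "edges F (Suc 0) = range Top_Edge"
| "edges F (Suc (Suc n)) = {Edge (Suc n) w v k | w v k. k < F $ v $ w}"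

definition in_edges :: "nat^'n^'n \<Rightarrow> 'n vertex \<Rightarrow> 'n edge set" where
  "in_edges F v = {e \<in> (\<Union>n. edges F n). rng e = v}"

section \<open>The path space\<close>

text \<open>
  Sequences are indexed from \<open>0\<close>: \<open>x i\<close> stands for the edge $x_{i+1} \in E_{i+1}$.
\<close>

type_synonym 'n path = "nat \<Rightarrow> 'n edge"

definition path_space :: "nat^'n^'n \<Rightarrow> 'n path set" where
  "path_space F = {x. \<forall>i. x i \<in> edges F (Suc i) \<and> rng (x i) = src (x (Suc i))}"

definition cylinder :: "nat^'n^'n \<Rightarrow> 'n path \<Rightarrow> nat \<Rightarrow> 'n path set" where
  "cylinder F y n = {x \<in> path_space F. \<forall>i<n. x i = y i}"

definition path_topology :: "nat^'n^'n \<Rightarrow> 'n path topology" where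
  "path_topology F = topology_generated_by {cylinder F y n | y n. y \<in> path_space F}"

section \<open>Orderings and Vershik maps\<close>

text \<open>
  An ordering is a family of (reflexive) linear orders, \<open>\<omega> v\<close> being the order on $r^{-1}(v)$.
\<close>

definition bratteli_ordering :: "nat^'n^'n \<Rightarrow> ('n vertex \<Rightarrow> 'n edge rel) \<Rightarrow> bool" where
  "bratteli_ordering F \<omega> \<longleftrightarrow>
     (\<forall>v \<in> (\<Union>n. vertices n) - {Root}. linear_order_on (in_edges F v) (\<omega> v))"

definition max_edge :: "nat^'n^'n \<Rightarrow> ('n vertex \<Rightarrow> 'n edge rel) \<Rightarrow> 'n edge \<Rightarrow> bool" where
  "max_edge F \<omega> e \<longleftrightarrow> e \<in> in_edges F (rng e) \<and> (\<forall>g \<in> in_edges F (rng e). (g, e) \<in> \<omega> (rng e))"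

definition min_edge :: "nat^'n^'n \<Rightarrow> ('n vertex \<Rightarrow> 'n edge rel) \<Rightarrow> 'n edge \<Rightarrow> bool" where
  "min_edge F \<omega> e \<longleftrightarrow> e \<in> in_edges F (rng e) \<and> (\<forall>g \<in> in_edges F (rng e). (e, g) \<in> \<omega> (rng e))"

definition max_paths :: "nat^'n^'n \<Rightarrow> ('n vertex \<Rightarrow> 'n edge rel) \<Rightarrow> 'n path set" where
  "max_paths F \<omega> = {x \<in> path_space F. \<forall>i. max_edge F \<omega> (x i)}"

definition min_paths :: "nat^'n^'n \<Rightarrow> ('n vertex \<Rightarrow> 'n edge rel) \<Rightarrow> 'n path set" where
  "min_paths F \<omega> = {x \<in> path_space F. \<forall>i. min_edge F \<omega> (x i)}"

text \<open>\<open>is_succ F \<omega> e e'\<close>: \<open>e'\<close> is the immediate successor of \<open>e\<close> in $r^{-1}(r(e))$.\<close>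

definition is_succ :: "nat^'n^'n \<Rightarrow> ('n vertex \<Rightarrow> 'n edge rel) \<Rightarrow> 'n edge \<Rightarrow> 'n edge \<Rightarrow> bool" where
  "is_succ F \<omega> e e' \<longleftrightarrow>
     e \<in> in_edges F (rng e) \<and> e' \<in> in_edges F (rng e) \<and> e' \<noteq> e \<and> (e, e') \<in> \<omega> (rng e) \<and>
     (\<forall>g \<in> in_edges F (rng e). (e, g) \<in> \<omega> (rng e) \<and> g \<noteq> e \<longrightarrow> (e', g) \<in> \<omega> (rng e))"

text \<open>
  Since \<open>\<phi> x\<close> is again a path, its first \<open>k\<close> edges form a path from the root to the source of
  \<open>\<phi> x k\<close>; requiring these edges to be minimal makes it the minimal path to that vertex.
\<close>

definition vershik_map_wrt ::
    "nat^'n^'n \<Rightarrow> ('n vertex \<Rightarrow> 'n edge rel) \<Rightarrow> ('n path \<Rightarrow> 'n path) \<Rightarrow> bool" where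
  "vershik_map_wrt F \<omega> \<phi> \<longleftrightarrow>
     homeomorphic_map (path_topology F) (path_topology F) \<phi> \<and>
     \<phi> ` max_paths F \<omega> = min_paths F \<omega> \<and>
     (\<forall>x \<in> path_space F - max_paths F \<omega>.
        let k = (LEAST n. \<not> max_edge F \<omega> (x n)) in
          (\<forall>i<k. min_edge F \<omega> (\<phi> x i)) \<and>
          is_succ F \<omega> (x k) (\<phi> x k) \<and>
          (\<forall>i>k. \<phi> x i = x i))"

definition vershik_map :: "nat^'n^'n \<Rightarrow> ('n path \<Rightarrow> 'n path) \<Rightarrow> bool" where
  "vershik_map F \<phi> \<longleftrightarrow> (\<exists>\<omega>. bratteli_ordering F \<omega> \<and> vershik_map_wrt F \<omega> \<phi>)"

section \<open>Orbit equivalence\<close>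

text \<open>The full orbit $\{T^n x : n \in \mathbf{Z}\}$ of a bijection \<open>T\<close> of the set \<open>X\<close>.\<close>

definition full_orbit :: "'a set \<Rightarrow> ('a \<Rightarrow> 'a) \<Rightarrow> 'a \<Rightarrow> 'a set" where
  "full_orbit X T x = range (\<lambda>n. (T ^^ n) x) \<union> range (\<lambda>n. (inv_into X T ^^ n) x)"

definition orbit_equivalent ::
    "'a topology \<Rightarrow> ('a \<Rightarrow> 'a) \<Rightarrow> 'b topology \<Rightarrow> ('b \<Rightarrow> 'b) \<Rightarrow> bool" where
  "orbit_equivalent X\<^sub>1 T\<^sub>1 X\<^sub>2 T\<^sub>2 \<longleftrightarrow>
     (\<exists>f. homeomorphic_map X\<^sub>1 X\<^sub>2 f \<and>
          (\<forall>x \<in> topspace X\<^sub>1.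
             f ` full_orbit (topspace X\<^sub>1) T\<^sub>1 x = full_orbit (topspace X\<^sub>2) T\<^sub>2 (f x)))"

end

theory Submission
  imports Defs
begin

text \<open>
  The obstruction is topological transitivity. In \<open>X\<^bsub>B\<^sub>1\<^esub>\<close> every path can be diverted to the second
  vertex, and tail-equivalent paths lie in the same \<open>\<phi>\<^sub>1\<close>-orbit, so two nonempty open
  \<open>\<phi>\<^sub>1\<close>-invariant sets always meet. In \<open>X\<^bsub>B\<^sub>2\<^esub>\<close> the first and the third vertex are absorbing: the
  paths that eventually reach the first one and those that eventually reach the third one form
  disjoint nonempty open sets, and both are \<open>\<phi>\<^sub>2\<close>-invariant. Off the extremal paths this holds
  because \<open>\<phi>\<^sub>2\<close> preserves tails; it extends to the extremal paths by continuity of \<open>\<phi>\<^sub>2\<close> and its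
  inverse.
\<close>

section \<open>Paths and cylinders\<close>

lemma edges_SucE:
  assumes "e \<in> edges F (Suc n)"
  obtains v where "rng e = Vertex (Suc n) v"
  using assms by (cases n) auto

lemma path_edge: "x \<in> path_space F \<Longrightarrow> x i \<in> edges F (Suc i)"
  and path_link: "x \<in> path_space F \<Longrightarrow> src (x (Suc i)) = rng (x i)"
  by (auto simp: path_space_def)

lemma path_rngE:
  assumes "x \<in> path_space F"
  obtains v where "rng (x n) = Vertex (Suc n) v"
  using path_edge[OF assms] edges_SucE by metis

lemma path_EdgeE:
  assumes "x \<in> path_space F"
  obtains w v k where "x (Suc n) = Edge (Suc n) w v k" "k < F $ v $ w"
    "rng (x n) = Vertex (Suc n) w"
proof -
  from path_edge[OF assms, of "Suc n"] obtain w v k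
    where *: "x (Suc n) = Edge (Suc n) w v k" "k < F $ v $ w" by auto
  with path_link[OF assms, of n] have "rng (x n) = Vertex (Suc n) w" by simp
  with * that show thesis by blast
qed

text \<open>The level stored in the range of an edge determines the level of the edge, so the union
  in \<open>in_edges\<close> collapses to a single level.\<close>

lemma in_edges_iff: "e \<in> in_edges F (Vertex (Suc n) v) \<longleftrightarrow> e \<in> edges F (Suc n) \<and> rng e = Vertex (Suc n) v"
proof -
  have "n = m" if "e \<in> edges F m'" "m' = Suc m" "rng e = Vertex (Suc n) v" for m m'
    using that edges_SucE[of e F m] by auto
  then have "m = Suc n" if "e \<in> edges F m" "rng e = Vertex (Suc n) v" for m
    using that by (cases m) auto
  then show ?thesis by (auto simp: in_edges_def)
qed

lemma path_in_edges: "x \<in> path_space F \<Longrightarrow> x i \<in> in_edges F (rng (x i))"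
  by (metis in_edges_iff path_edge path_rngE)

lemma finite_in_edges: "finite (in_edges F (Vertex (Suc n) v))"
proof (cases n)
  case 0
  then have "in_edges F (Vertex (Suc n) v) \<subseteq> {Top_Edge v}" by (auto simp: in_edges_iff)
  then show ?thesis by (rule finite_subset) simp
next
  case (Suc m)
  have "in_edges F (Vertex (Suc n) v) \<subseteq> (\<Union>w. Edge n w v ` {..<F $ v $ w})"
  proof
    fix e assume "e \<in> in_edges F (Vertex (Suc n) v)"
    then obtain w k where "e = Edge n w v k" "k < F $ v $ w"
      unfolding in_edges_iff Suc by auto
    then show "e \<in> (\<Union>w. Edge n w v ` {..<F $ v $ w})" by blast
  qed
  then show ?thesis by (rule finite_subset) auto
qed

section \<open>Explicit paths: looping at a vertex and splicing\<close>

definition stay :: "'n \<Rightarrow> nat \<Rightarrow> 'n path" where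
  "stay v k i = (case i of 0 \<Rightarrow> Top_Edge v | Suc m \<Rightarrow> Edge (Suc m) v v k)"

lemma rng_stay [simp]: "rng (stay v k i) = Vertex (Suc i) v"
  by (auto simp: stay_def split: nat.splits)

lemma stay_path: "k < F $ v $ v \<Longrightarrow> stay v k \<in> path_space F"
proof -
  assume "k < F $ v $ v"
  then have "stay v k i \<in> edges F (Suc i)" for i by (cases i) (auto simp: stay_def)
  moreover have "src (stay v k (Suc i)) = Vertex (Suc i) v" for i by (simp add: stay_def)
  ultimately show ?thesis by (auto simp: path_space_def)
qed

definition path_splice :: "'n path \<Rightarrow> nat \<Rightarrow> 'n path \<Rightarrow> 'n path" where
  "path_splice x n y i = (if i \<le> n then x i else y i)"

lemma path_splice_in:
  assumes "x \<in> path_space F" "y \<in> path_space F" "rng (x n) = rng (y n)"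
  shows "path_splice x n y \<in> path_space F"
proof -
  have "path_splice x n y i \<in> edges F (Suc i)" for i
    using assms(1,2) by (simp add: path_splice_def path_edge)
  moreover have "rng (path_splice x n y i) = src (path_splice x n y (Suc i))" for i
    using assms by (cases "i < n"; cases "i = n") (auto simp: path_splice_def path_link)
  ultimately show ?thesis by (auto simp: path_space_def)
qed

section \<open>The cylinder topology\<close>

lemma topspace_path_topology [simp]: "topspace (path_topology F) = path_space F"
  unfolding path_topology_def topology_generated_by_topspace
  by (auto simp: cylinder_def)

lemma cylinder_self: "x \<in> path_space F \<Longrightarrow> x \<in> cylinder F x n"
  by (simp add: cylinder_def)

lemma openin_cylinder: "x \<in> path_space F \<Longrightarrow> openin (path_topology F) (cylinder F x n)"
  unfolding path_topology_def by (rule topology_generated_by_Basis) blast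

lemma cylinder_antimono: "m \<le> n \<Longrightarrow> cylinder F x n \<subseteq> cylinder F x m"
  by (auto simp: cylinder_def)

text \<open>A basic cylinder is also the cylinder of the same depth about each of its points, and
  cylinders about a fixed point are nested, so an intersection of two contains the deeper
  one.\<close>

lemma openin_path_topologyE:
  assumes "openin (path_topology F) U" "x \<in> U"
  obtains n where "cylinder F x n \<subseteq> U"
proof -
  have "generate_topology_on {cylinder F y n | y n. y \<in> path_space F} U"
    using assms(1) by (simp add: path_topology_def openin_topology_generated_by_iff)
  then have "\<forall>x\<in>U. \<exists>n. cylinder F x n \<subseteq> U"
  proof induction
    case (Int a b)
    show ?case
    proof
      fix x assume "x \<in> a \<inter> b"
      then obtain m n where "cylinder F x m \<subseteq> a" "cylinder F x n \<subseteq> b" using Int by blast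
      then have "cylinder F x (max m n) \<subseteq> a \<inter> b"
        using cylinder_antimono[of m "max m n"] cylinder_antimono[of n "max m n"] by fastforce
      then show "\<exists>n. cylinder F x n \<subseteq> a \<inter> b" ..
    qed
  next
    case (Basis s)
    then obtain y n where s: "s = cylinder F y n" by auto
    then have "\<forall>x\<in>s. cylinder F x n \<subseteq> s" by (auto simp: cylinder_def)
    then show ?case by blast
  qed blast+
  with assms(2) that show thesis by blast
qed

section \<open>Finite linear orders\<close>

lemma linear_order_on_total:
  "linear_order_on A r \<Longrightarrow> a \<in> A \<Longrightarrow> b \<in> A \<Longrightarrow> (a, b) \<in> r \<or> (b, a) \<in> r"
  by (cases "a = b") (auto simp: order_on_defs refl_on_def total_on_def)

lemma linear_order_on_ex_max:
  assumes "linear_order_on A r" "finite B" "B \<noteq> {}" "B \<subseteq> A"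
  shows "\<exists>m\<in>B. \<forall>b\<in>B. (b, m) \<in> r"
  using assms(2-4)
proof (induction B rule: finite_ne_induct)
  case (singleton x)
  with assms(1) show ?case by (auto simp: order_on_defs refl_on_def)
next
  case (insert x B)
  then obtain m where m: "m \<in> B" "\<forall>b\<in>B. (b, m) \<in> r" by auto
  have refl: "(x, x) \<in> r" "(m, m) \<in> r" and tr: "trans r"
    using assms(1) insert.prems m(1) by (auto simp: order_on_defs refl_on_def)
  have "(x, m) \<in> r \<or> (m, x) \<in> r"
    using linear_order_on_total[OF assms(1)] insert.prems m(1) by blast
  then show ?case
  proof
    assume "(x, m) \<in> r" with m show ?thesis by auto
  next
    assume "(m, x) \<in> r"
    with m tr refl show ?thesis by (intro bexI[of _ x]) (auto dest: transD)
  qed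
qed

lemma linear_order_on_ex_min:
  assumes "linear_order_on A r" "finite B" "B \<noteq> {}" "B \<subseteq> A"
  shows "\<exists>m\<in>B. \<forall>b\<in>B. (m, b) \<in> r"
  using linear_order_on_ex_max[of A "r\<inverse>" B] assms by simp

text \<open>Take the least failure \<open>h\<close> above \<open>a\<close>, and the greatest
  \<open>g\<close> other than \<open>h\<close> between \<open>a\<close> and \<open>h\<close>: then
  \<open>P g\<close> holds and \<open>h\<close> is the immediate successor of
  \<open>g\<close>.\<close>

lemma linear_order_on_succ_induct:
  assumes r: "linear_order_on A r" and fin: "finite A" and a: "a \<in> A"
    and ab: "(a, b) \<in> r" "b \<in> A" and base: "P a"
    and step: "\<And>g h. g \<in> A \<Longrightarrow> h \<in> A \<Longrightarrow> h \<noteq> g \<Longrightarrow> (g, h) \<in> r \<Longrightarrow>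
      (\<And>c. c \<in> A \<Longrightarrow> (g, c) \<in> r \<Longrightarrow> c \<noteq> g \<Longrightarrow> (h, c) \<in> r) \<Longrightarrow> P g \<Longrightarrow> P h"
  shows "P b"
proof (rule ccontr)
  assume "\<not> P b"
  have tr: "trans r" and an: "antisym r" and re: "\<And>c. c \<in> A \<Longrightarrow> (c, c) \<in> r"
    using r by (auto simp: order_on_defs refl_on_def)
  define bad where "bad = {c \<in> A. (a, c) \<in> r \<and> \<not> P c}"
  have "\<exists>m\<in>bad. \<forall>c\<in>bad. (m, c) \<in> r"
    by (rule linear_order_on_ex_min[OF r]) (use \<open>\<not> P b\<close> ab fin in \<open>auto simp: bad_def\<close>)
  then obtain h where h: "h \<in> A" "(a, h) \<in> r" "\<not> P h"
    and hmin: "\<And>c. c \<in> A \<Longrightarrow> (a, c) \<in> r \<Longrightarrow> \<not> P c \<Longrightarrow> (h, c) \<in> r"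
    by (auto simp: bad_def)
  define below where "below = {c \<in> A. (a, c) \<in> r \<and> (c, h) \<in> r \<and> c \<noteq> h}"
  have "a \<in> below" using a h base re by (auto simp: below_def)
  then have "\<exists>m\<in>below. \<forall>c\<in>below. (c, m) \<in> r"
    by (intro linear_order_on_ex_max[OF r]) (use fin in \<open>auto simp: below_def\<close>)
  then obtain g where g: "g \<in> A" "(a, g) \<in> r" "(g, h) \<in> r" "g \<noteq> h"
    and gmax: "\<And>c. c \<in> A \<Longrightarrow> (a, c) \<in> r \<Longrightarrow> (c, h) \<in> r \<Longrightarrow> c \<noteq> h \<Longrightarrow> (c, g) \<in> r"
    by (auto simp: below_def)
  have "P g" using hmin[of g] g an by (auto dest: antisymD)
  \<comment> \<open>If this failed, totality would put \<open>c\<close> strictly below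
    \<open>h\<close>; then \<open>gmax\<close> gives \<open>(c, g) \<in> r\<close>, and antisymmetry
    forces \<open>c = g\<close>.\<close>
  moreover have "(h, c) \<in> r" if "c \<in> A" "(g, c) \<in> r" "c \<noteq> g" for c
    using that g h gmax[of c] linear_order_on_total[OF r, of c h] re tr an by (metis antisymD transD)
  ultimately have "P h" using g h by (intro step[of g h]) auto
  with h show False by simp
qed

section \<open>Vershik maps and tail equivalence\<close>

lemma bratteli_ordering_linear:
  "bratteli_ordering F \<omega> \<Longrightarrow> linear_order_on (in_edges F (Vertex (Suc n) v)) (\<omega> (Vertex (Suc n) v))"
proof -
  have "Vertex (Suc n) v \<in> vertices (Suc n)" by (simp add: vertices_def)
  then have "Vertex (Suc n) v \<in> (\<Union>n. vertices n) - {Root}" by blast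
  then show "bratteli_ordering F \<omega> \<Longrightarrow> ?thesis" unfolding bratteli_ordering_def by blast
qed

lemma bratteli_ordering_converse:
  "bratteli_ordering F \<omega> \<Longrightarrow> bratteli_ordering F (\<lambda>v. (\<omega> v)\<inverse>)"
  by (simp add: bratteli_ordering_def)

text \<open>Reversing all orders swaps the two kinds of extremal edge, so facts about maximal edges
  transfer to minimal ones.\<close>

lemma min_edge_converse: "min_edge F \<omega> = max_edge F (\<lambda>v. (\<omega> v)\<inverse>)"
  by (auto simp: fun_eq_iff min_edge_def max_edge_def)

text \<open>The positive diagonal provides a loop at every vertex, hence a path from the root to the
  source of \<open>e\<close>; it replaces whatever preceded index \<open>m\<close> in
  \<open>x\<close>.\<close>

lemma ex_path_through_edge:
  assumes "\<And>v. F $ v $ v > 0" "x \<in> path_space F" "e \<in> in_edges F (rng (x m))"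
  shows "\<exists>z\<in>path_space F. z m = e \<and> (\<forall>i>m. z i = x i)"
proof -
  obtain v where v: "rng (x m) = Vertex (Suc m) v" using assms(2) path_rngE by metis
  with assms(3) have e: "e \<in> edges F (Suc m)" "rng e = rng (x m)"
    by (auto simp: in_edges_iff)
  \<comment> \<open>For a \<open>Top_Edge\<close> the value is a filler: then \<open>m = 0\<close>
    and no index lies before \<open>m\<close>.\<close>
  define w where "w = (case e of Top_Edge u \<Rightarrow> u | Edge _ u _ _ \<Rightarrow> u)"
  have src: "src e = Vertex m w" if "m = Suc k" for k
    using e that by (auto simp: w_def)
  define z where "z i = (if i < m then stay w 0 i else if i = m then e else x i)" for i
  have "z i \<in> edges F (Suc i)" for i
    using e assms(2) path_edge[OF stay_path[of 0 F w]] assms(1)[of w] by (auto simp: z_def path_edge)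
  moreover have "rng (z i) = src (z (Suc i))" for i
  proof -
    consider "Suc i < m" | "Suc i = m" | "i = m" | "i > m" by linarith
    then show ?thesis
    proof cases
      case 1
      then show ?thesis by (simp add: z_def path_link[OF stay_path[of 0 F w]] assms(1))
    qed (use e src path_link[OF assms(2)] in \<open>auto simp: z_def\<close>)
  qed
  ultimately have "z \<in> path_space F" by (auto simp: path_space_def)
  then show ?thesis by (intro bexI[of _ z]) (auto simp: z_def)
qed

text \<open>Works from the top index down: a maximal edge into the same vertex replaces the last
  edge of the segment, and induction treats the shorter rest. The purpose is to let
  \<open>\<phi>\<close> advance a prescribed non-maximal edge.\<close>

lemma ex_initially_max_path:
  assumes "\<And>v. F $ v $ v > 0" "bratteli_ordering F \<omega>" "x \<in> path_space F"
  shows "\<exists>z\<in>path_space F. (\<forall>i<m. max_edge F \<omega> (z i)) \<and> (\<forall>i\<ge>m. z i = x i)"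
  using assms(3)
proof (induction m arbitrary: x)
  case (Suc m)
  obtain v where v: "rng (x m) = Vertex (Suc m) v" using Suc.prems path_rngE by metis
  have "\<exists>e\<in>in_edges F (rng (x m)). \<forall>g\<in>in_edges F (rng (x m)). (g, e) \<in> \<omega> (rng (x m))"
    unfolding v
    by (rule linear_order_on_ex_max[OF bratteli_ordering_linear[OF assms(2)]])
      (use path_in_edges[OF Suc.prems, of m] v finite_in_edges in auto)
  then obtain e where e: "e \<in> in_edges F (rng (x m))" "max_edge F \<omega> e"
    by (auto simp: max_edge_def in_edges_def)
  obtain y where y: "y \<in> path_space F" "y m = e" "\<forall>i>m. y i = x i"
    using ex_path_through_edge[OF assms(1) Suc.prems e(1)] by blast
  obtain z where "z \<in> path_space F" "\<forall>i<m. max_edge F \<omega> (z i)" "\<forall>i\<ge>m. z i = y i"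
    using Suc.IH[OF y(1)] by blast
  with y e show ?case by (intro bexI[of _ z]) (auto simp: less_Suc_eq)
qed auto

section \<open>Action of a Vershik map on paths\<close>

lemma vershik_map_wrt_succ:
  assumes "vershik_map_wrt F \<omega> \<phi>" "x \<in> path_space F"
    and "\<forall>i<m. max_edge F \<omega> (x i)" "\<not> max_edge F \<omega> (x m)"
  shows "is_succ F \<omega> (x m) (\<phi> x m) \<and> (\<forall>i>m. \<phi> x i = x i)"
proof -
  have least: "(LEAST n. \<not> max_edge F \<omega> (x n)) = m"
    using assms(3,4) by (intro Least_equality) (auto intro: leI)
  have x: "x \<in> path_space F - max_paths F \<omega>" using assms(2,4) by (auto simp: max_paths_def)
  have "\<forall>x\<in>path_space F - max_paths F \<omega>.
      let k = (LEAST n. \<not> max_edge F \<omega> (x n)) in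
        (\<forall>i<k. min_edge F \<omega> (\<phi> x i)) \<and> is_succ F \<omega> (x k) (\<phi> x k) \<and> (\<forall>i>k. \<phi> x i = x i)"
    using assms(1) unfolding vershik_map_wrt_def by (elim conjE)
  from bspec[OF this x] show ?thesis unfolding Let_def least by (elim conjE) (rule conjI)
qed

lemma vershik_map_wrt_tail:
  assumes "vershik_map_wrt F \<omega> \<phi>" "x \<in> path_space F" "x \<notin> max_paths F \<omega>"
  shows "\<exists>k. \<forall>i>k. \<phi> x i = x i"
proof -
  have "\<exists>n. \<not> max_edge F \<omega> (x n)" using assms(2,3) by (simp add: max_paths_def)
  then obtain k where "\<not> max_edge F \<omega> (x k)" "\<forall>i<k. max_edge F \<omega> (x i)"
    using exists_least_iff[of "\<lambda>n. \<not> max_edge F \<omega> (x n)"] by blast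
  with vershik_map_wrt_succ[OF assms(1,2)] show ?thesis by blast
qed

lemma vershik_map_image: "vershik_map_wrt F \<omega> \<phi> \<Longrightarrow> \<phi> ` path_space F = path_space F"
  using homeomorphic_imp_surjective_map[of "path_topology F" "path_topology F" \<phi>]
  by (simp add: vershik_map_wrt_def)

lemma vershik_map_path: "vershik_map_wrt F \<omega> \<phi> \<Longrightarrow> x \<in> path_space F \<Longrightarrow> \<phi> x \<in> path_space F"
  using imageI[of x "path_space F" \<phi>] by (simp add: vershik_map_image)

text \<open>
  Two edges into the same vertex are linked by successor steps; such a step is realised by \<open>\<phi>\<close>
  once the initial segment has been made maximal, which the induction hypothesis permits.
\<close>

lemma tail_equivalent_saturated:
  assumes diag: "\<And>v. F $ v $ v > 0" and ord: "bratteli_ordering F \<omega>"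
    and vm: "vershik_map_wrt F \<omega> \<phi>"
    and sat: "\<And>x. x \<in> path_space F \<Longrightarrow> \<phi> x \<in> S \<longleftrightarrow> x \<in> S"
    and "x \<in> path_space F" "y \<in> path_space F" "\<forall>i\<ge>m. x i = y i"
  shows "x \<in> S \<longleftrightarrow> y \<in> S"
  using assms(5-)
proof (induction m arbitrary: x y)
  case 0
  then have "x = y" by auto
  then show ?case by simp
next
  case (Suc m)
  have rng: "rng (x m) = rng (y m)"
    using Suc.prems(3) path_link[OF Suc.prems(1), of m] path_link[OF Suc.prems(2), of m] by simp
  obtain v where v: "rng (x m) = Vertex (Suc m) v" using Suc.prems(1) path_rngE by metis
  let ?V = "Vertex (Suc m) v"
  note lin = bratteli_ordering_linear[OF ord, of m v]
  have tail: "a \<in> S \<longleftrightarrow> b \<in> S" if "a \<in> path_space F" "b \<in> path_space F"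
    "\<forall>i>m. a i = x i" "\<forall>i>m. b i = x i" "(a m, b m) \<in> \<omega> ?V"
    "a m \<in> in_edges F ?V" "b m \<in> in_edges F ?V" for a b
  proof -
    \<comment> \<open>By the induction hypothesis, membership in \<open>S\<close> depends only on
      the edge at \<open>m\<close> once the tail is that of \<open>x\<close>; \<open>P e\<close>
      says that the edge \<open>e\<close> gives the same answer as \<open>a\<close>.\<close>
    define P where
      "P e \<longleftrightarrow> (\<forall>z\<in>path_space F. z m = e \<and> (\<forall>i>m. z i = x i) \<longrightarrow> (z \<in> S \<longleftrightarrow> a \<in> S))" for e
    have "P (b m)"
    proof (rule linear_order_on_succ_induct[OF lin finite_in_edges that(6,5,7)])
      show "P (a m)"
        unfolding P_def
      proof (intro ballI impI)
        fix z assume "z \<in> path_space F" "z m = a m \<and> (\<forall>i>m. z i = x i)"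
        then show "z \<in> S \<longleftrightarrow> a \<in> S" using that(1,3) by (intro Suc.IH) (auto simp: le_less)
      qed
    next
      fix g h
      assume gh: "g \<in> in_edges F ?V" "h \<in> in_edges F ?V" "h \<noteq> g" "(g, h) \<in> \<omega> ?V"
        and imm: "\<And>c. c \<in> in_edges F ?V \<Longrightarrow> (g, c) \<in> \<omega> ?V \<Longrightarrow> c \<noteq> g \<Longrightarrow> (h, c) \<in> \<omega> ?V"
        and "P g"
      have rg: "rng g = ?V" using gh(1) by (simp add: in_edges_iff)
      obtain z where z: "z \<in> path_space F" "z m = g" "\<forall>i>m. z i = x i"
        using ex_path_through_edge[OF diag Suc.prems(1), of g m] gh(1) v by auto
      \<comment> \<open>All edges of \<open>u\<close> before \<open>m\<close> are maximal while
        \<open>u m = g\<close> is not, so \<open>\<phi>\<close> replaces \<open>g\<close> by its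
        successor \<open>h\<close> and keeps the tail.\<close>
      obtain u where u: "u \<in> path_space F" "\<forall>i<m. max_edge F \<omega> (u i)" "\<forall>i\<ge>m. u i = z i"
        using ex_initially_max_path[OF diag ord z(1)] by blast
      have an: "antisym (\<omega> ?V)" using lin by (auto simp: order_on_defs)
      have um: "u m = g" using u(3) z(2) by simp
      have "(h, g) \<notin> \<omega> ?V" using antisymD[OF an gh(4)] gh(3) by blast
      then have "\<not> max_edge F \<omega> (u m)" using gh(2) unfolding max_edge_def um rg by blast
      with vershik_map_wrt_succ[OF vm u(1,2)]
      have succ: "is_succ F \<omega> (u m) (\<phi> u m)" "\<forall>i>m. \<phi> u i = u i" by blast+
      have "(h, \<phi> u m) \<in> \<omega> ?V" "(\<phi> u m, h) \<in> \<omega> ?V"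
        using succ(1) gh imm unfolding is_succ_def um rg by blast+
      then have \<phi>um: "\<phi> u m = h" using antisymD[OF an] by blast
      have u_tail: "\<forall>i>m. u i = x i" using u(3) z(3) by simp
      have "u \<in> S \<longleftrightarrow> a \<in> S"
        using \<open>P g\<close> u(1) um u_tail unfolding P_def by blast
      then have "\<phi> u \<in> S \<longleftrightarrow> a \<in> S" using sat[OF u(1)] by blast
      \<comment> \<open>Both paths have edge \<open>h\<close> at \<open>m\<close> and the tail of
        \<open>x\<close>, so they agree from \<open>m\<close> on.\<close>
      moreover have "t \<in> S \<longleftrightarrow> \<phi> u \<in> S" if "t \<in> path_space F" "t m = h" "\<forall>i>m. t i = x i" for t
        using that \<phi>um succ(2) u_tail vershik_map_path[OF vm u(1)]
        by (intro Suc.IH) (auto simp: le_less)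
      ultimately show "P h" unfolding P_def by blast
    qed
    then show ?thesis using that unfolding P_def by blast
  qed
  have mem: "x m \<in> in_edges F ?V" "y m \<in> in_edges F ?V"
    using path_in_edges[OF Suc.prems(1), of m] path_in_edges[OF Suc.prems(2), of m] rng v by auto
  have "(x m, y m) \<in> \<omega> ?V \<or> (y m, x m) \<in> \<omega> ?V"
    using linear_order_on_total[OF lin mem] .
  moreover have "\<forall>i>m. y i = x i" using Suc.prems(3) by simp
  ultimately show ?case
    using tail[OF Suc.prems(1,2) _ _ _ mem] tail[OF Suc.prems(2,1) _ _ _ mem(2,1)] by blast
qed

section \<open>Absorbing vertices\<close>

text \<open>A closed set; for absorbing \<open>w\<close> its complement consists of the paths that
  end up at \<open>w\<close> for good. The indices from \<open>0\<close> on cover every level except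
  the root.\<close>

definition avoiding :: "nat^'n^'n \<Rightarrow> 'n \<Rightarrow> 'n path set" where
  "avoiding F w = {x \<in> path_space F. \<forall>i. rng (x i) \<noteq> Vertex (Suc i) w}"

text \<open>\<open>F $ v $ w\<close> counts the edges from \<open>w\<close> to \<open>v\<close>, so
  a column that vanishes off the diagonal leaves no exit from \<open>w\<close>.\<close>

lemma absorbing_stays:
  assumes "\<And>v. v \<noteq> w \<Longrightarrow> F $ v $ w = 0" "x \<in> path_space F" "rng (x i) = Vertex (Suc i) w" "i \<le> j"
  shows "rng (x j) = Vertex (Suc j) w"
  using assms(4)
proof (induction rule: dec_induct)
  case base
  show ?case by fact
next
  case (step j)
  obtain u v k where e: "x (Suc j) = Edge (Suc j) u v k" "k < F $ v $ u" "rng (x j) = Vertex (Suc j) u"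
    using path_EdgeE[OF assms(2)] .
  with step.IH have "u = w" by simp
  with e(2) assms(1)[of v] have "v = w" by auto
  with e show ?case by simp
qed

text \<open>A visit to \<open>w\<close> at index \<open>i\<close> is decided by the first
  \<open>Suc i\<close> edges.\<close>

lemma openin_not_avoiding: "openin (path_topology F) (path_space F - avoiding F w)"
proof (subst openin_subopen, intro ballI)
  fix x assume "x \<in> path_space F - avoiding F w"
  then obtain i where x: "x \<in> path_space F" "rng (x i) = Vertex (Suc i) w"
    by (auto simp: avoiding_def)
  have "cylinder F x (Suc i) \<subseteq> path_space F - avoiding F w"
  proof
    fix z assume "z \<in> cylinder F x (Suc i)"
    then have "z i = x i" "z \<in> path_space F" by (simp_all add: cylinder_def)
    with x(2) have "rng (z i) = Vertex (Suc i) w" by simp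
    with \<open>z \<in> path_space F\<close> show "z \<in> path_space F - avoiding F w" by (auto simp: avoiding_def)
  qed
  with openin_cylinder[OF x(1)] cylinder_self[OF x(1)]
  show "\<exists>T. openin (path_topology F) T \<and> x \<in> T \<and> T \<subseteq> path_space F - avoiding F w"
    by (intro exI[of _ "cylinder F x (Suc i)"] conjI)
qed

text \<open>A visit to an absorbing \<open>w\<close> is still visible beyond \<open>k\<close>, where
  the two paths coincide.\<close>

lemma avoiding_tail:
  assumes "\<And>v. v \<noteq> w \<Longrightarrow> F $ v $ w = 0" "x \<in> path_space F" "y \<in> path_space F" "\<forall>i>k. x i = y i"
  shows "x \<in> avoiding F w \<longleftrightarrow> y \<in> avoiding F w"
proof -
  have *: "b \<notin> avoiding F w" if "a \<in> path_space F" "b \<in> path_space F" "\<forall>i>k. a i = b i"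
    and a: "a \<notin> avoiding F w" for a b
  proof -
    obtain i where i: "rng (a i) = Vertex (Suc i) w" using \<open>a \<in> _\<close> a by (auto simp: avoiding_def)
    have "rng (a (Suc (max i k))) = Vertex (Suc (Suc (max i k))) w"
      by (rule absorbing_stays[OF assms(1) that(1) i]) auto
    with that(3) have "rng (b (Suc (max i k))) = Vertex (Suc (Suc (max i k))) w" by simp
    then show ?thesis by (auto simp: avoiding_def)
  qed
  have "\<forall>i>k. y i = x i" using assms(4) by simp
  from *[OF assms(3,2) this] *[OF assms(2,3,4)] show ?thesis by blast
qed

text \<open>Non-maximal paths are dense in \<open>avoiding F w\<close>: follow \<open>x\<close>
  through index \<open>n\<close>, then loop forever at the vertex reached, which is not
  \<open>w\<close>. Of the loops labelled \<open>0\<close> and \<open>1\<close> at most one is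
  maximal, so the other can be chosen.\<close>

lemma avoiding_ex_nonmax:
  assumes diag: "\<And>v. F $ v $ v \<ge> 2" and ord: "bratteli_ordering F \<omega>" and x: "x \<in> avoiding F w"
  shows "\<exists>y\<in>avoiding F w \<inter> cylinder F x n. \<not> max_edge F \<omega> (y (Suc n))"
proof -
  have xp: "x \<in> path_space F" using x by (simp add: avoiding_def)
  then obtain v where v: "rng (x n) = Vertex (Suc n) v" using path_rngE by metis
  with x have "v \<noteq> w" by (auto simp: avoiding_def)
  let ?e = "Edge (Suc n) v v"
  have "\<exists>k<2. \<not> max_edge F \<omega> (?e k)"
  proof (rule ccontr)
    assume "\<not> ?thesis"
    then have "max_edge F \<omega> (?e 0)" "max_edge F \<omega> (?e 1)" by auto
    moreover have "antisym (\<omega> (Vertex (Suc (Suc n)) v))"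
      using bratteli_ordering_linear[OF ord, of "Suc n" v] by (auto simp: order_on_defs)
    ultimately have "?e 0 = ?e 1" unfolding max_edge_def by (auto dest: antisymD)
    then show False by simp
  qed
  then obtain k where k: "k < 2" "\<not> max_edge F \<omega> (?e k)" by blast
  then have sp: "stay v k \<in> path_space F" using diag[of v] by (intro stay_path) linarith
  let ?y = "path_splice x n (stay v k)"
  have yp: "?y \<in> path_space F" by (rule path_splice_in[OF xp sp]) (simp add: v)
  have "?y \<in> avoiding F w" using yp x \<open>v \<noteq> w\<close> by (auto simp: avoiding_def path_splice_def)
  moreover have "?y \<in> cylinder F x n" using yp by (auto simp: cylinder_def path_splice_def)
  moreover have "?y (Suc n) = ?e k" by (simp add: path_splice_def stay_def)
  ultimately show ?thesis using k(2) by (intro bexI[of _ ?y]) auto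
qed

text \<open>Off the maximal paths \<open>\<phi>\<close> changes finitely many edges, and
  \<open>avoiding_tail\<close> applies. The maximal paths follow because the set is closed and its
  non-extremal members are dense in it.\<close>

lemma avoiding_invariant:
  assumes diag: "\<And>v. F $ v $ v \<ge> 2" and abs: "\<And>v. v \<noteq> w \<Longrightarrow> F $ v $ w = 0"
    and ord: "bratteli_ordering F \<omega>" and vm: "vershik_map_wrt F \<omega> \<phi>" and x: "x \<in> path_space F"
  shows "\<phi> x \<in> avoiding F w \<longleftrightarrow> x \<in> avoiding F w"
proof -
  let ?K = "avoiding F w" and ?X = "path_space F" and ?T = "path_topology F"
  have hom: "homeomorphic_map ?T ?T \<phi>" and maxmin: "\<phi> ` max_paths F \<omega> = min_paths F \<omega>"
    using vm by (auto simp: vershik_map_wrt_def)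
  have nonmax: "\<phi> z \<in> ?K \<longleftrightarrow> z \<in> ?K" if "z \<in> ?X" "z \<notin> max_paths F \<omega>" for z
  proof -
    from vershik_map_wrt_tail[OF vm that] obtain k where "\<forall>i>k. \<phi> z i = z i" ..
    from avoiding_tail[OF abs vershik_map_path[OF vm that(1)] that(1) this] show ?thesis .
  qed
  show ?thesis
  proof
    assume xK: "x \<in> ?K"
    show "\<phi> x \<in> ?K"
    proof (rule ccontr)
      assume "\<phi> x \<notin> ?K"
      \<comment> \<open>By continuity \<open>\<phi>\<close> would map a whole cylinder about
        \<open>x\<close> out of \<open>?K\<close>, but that cylinder contains a non-maximal path of
        \<open>?K\<close>.\<close>
      let ?V = "{z \<in> ?X. \<phi> z \<in> ?X - ?K}"
      have "openin ?T ?V"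
        using homeomorphic_imp_continuous_map[OF hom] openin_not_avoiding[of F w]
        by (auto simp: continuous_map_def)
      moreover have "x \<in> ?V" using x \<open>\<phi> x \<notin> ?K\<close> vershik_map_path[OF vm] by simp
      ultimately obtain n where n: "cylinder F x n \<subseteq> ?V" using openin_path_topologyE by metis
      obtain y where y: "y \<in> ?K" "y \<in> cylinder F x n" "\<not> max_edge F \<omega> (y (Suc n))"
        using avoiding_ex_nonmax[OF diag ord xK] by blast
      then have "\<phi> y \<in> ?K" using nonmax[of y] by (auto simp: avoiding_def max_paths_def)
      with y n show False by blast
    qed
  next
    assume xK: "\<phi> x \<in> ?K"
    show "x \<in> ?K"
    proof (rule ccontr)
      assume "x \<notin> ?K"
      \<comment> \<open>As \<open>\<phi>\<close> is open, every path near \<open>\<phi> x\<close>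
        would come from outside \<open>?K\<close>. A nearby non-minimal path in \<open>?K\<close>
        has a non-maximal preimage, since \<open>\<phi>\<close> sends maximal paths to minimal ones;
        this contradicts \<open>nonmax\<close>.\<close>
      let ?V = "\<phi> ` (?X - ?K)"
      have "openin ?T ?V"
        using homeomorphic_imp_open_map[OF hom] openin_not_avoiding[of F w] by (auto simp: open_map_def)
      moreover have "\<phi> x \<in> ?V" using x \<open>x \<notin> ?K\<close> by simp
      ultimately obtain n where n: "cylinder F (\<phi> x) n \<subseteq> ?V" using openin_path_topologyE by metis
      obtain y where y: "y \<in> ?K" "y \<in> cylinder F (\<phi> x) n" "\<not> min_edge F \<omega> (y (Suc n))"
        using avoiding_ex_nonmax[OF diag bratteli_ordering_converse[OF ord] xK, of n]
        by (auto simp: min_edge_converse)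
      then obtain z where z: "z \<in> ?X - ?K" "y = \<phi> z" using n by blast
      have "y \<notin> min_paths F \<omega>" using y(3) by (auto simp: min_paths_def)
      then have "z \<notin> max_paths F \<omega>" using z(2) imageI[of z "max_paths F \<omega>" \<phi>] by (auto simp: maxmin)
      with z y nonmax[of z] show False by blast
    qed
  qed
qed

section \<open>Orbits\<close>

text \<open>Surjectivity makes \<open>inv_into X T\<close> a right inverse of \<open>T\<close> on
  \<open>X\<close>, so invariance at the preimage settles each backward step.\<close>

lemma full_orbit_invariant:
  assumes bij: "T ` X = X" and inv: "\<And>x. x \<in> X \<Longrightarrow> T x \<in> K \<longleftrightarrow> x \<in> K"
    and "x \<in> X" "y \<in> full_orbit X T x"
  shows "y \<in> K \<longleftrightarrow> x \<in> K"
proof -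
  have "(T ^^ n) x \<in> X \<and> ((T ^^ n) x \<in> K \<longleftrightarrow> x \<in> K)" for n
    by (induction n) (use assms in auto)
  moreover have "(inv_into X T ^^ n) x \<in> X \<and> ((inv_into X T ^^ n) x \<in> K \<longleftrightarrow> x \<in> K)" for n
  proof (induction n)
    case (Suc n)
    let ?z = "(inv_into X T ^^ n) x"
    have "inv_into X T ?z \<in> X" "T (inv_into X T ?z) = ?z"
      using Suc bij by (simp_all add: inv_into_into f_inv_into_f)
    with Suc inv[of "inv_into X T ?z"] show ?case by simp
  qed (use assms in auto)
  ultimately show ?thesis using assms(4) by (auto simp: full_orbit_def)
qed

text \<open>\<open>f\<close> need not intertwine the two maps, but it carries \<open>T x\<close>, a
  point of the orbit of \<open>x\<close>, into the orbit of \<open>f x\<close>, on which membership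
  in \<open>K\<close> is constant.\<close>

lemma orbit_equivalence_pullback_invariant:
  assumes "f ` full_orbit X T x = full_orbit Y T' (f x)" "f x \<in> Y"
    and "T' ` Y = Y" "\<And>y. y \<in> Y \<Longrightarrow> T' y \<in> K \<longleftrightarrow> y \<in> K"
  shows "f (T x) \<in> K \<longleftrightarrow> f x \<in> K"
proof -
  have "(T ^^ 1) x \<in> full_orbit X T x" unfolding full_orbit_def by blast
  then have "f (T x) \<in> full_orbit Y T' (f x)" using assms(1) by auto
  then show ?thesis using full_orbit_invariant[OF assms(3,4,2)] by blast
qed

text \<open>As row \<open>w\<close> is positive, every vertex has an edge into \<open>w\<close>, so
  every cylinder contains a path ending in the loops \<open>Edge i w w 0\<close>. Two such paths,
  one in \<open>U\<close> and one in \<open>V\<close>, share a tail, and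
  \<open>tail_equivalent_saturated\<close> puts both in \<open>U\<close>.\<close>

lemma vershik_map_transitive:
  assumes diag: "\<And>v. F $ v $ v > 0" and reach: "\<And>v. F $ w $ v > 0"
    and ord: "bratteli_ordering F \<omega>" and vm: "vershik_map_wrt F \<omega> \<phi>"
    and U: "openin (path_topology F) U" "U \<noteq> {}"
    and U_inv: "\<And>x. x \<in> path_space F \<Longrightarrow> \<phi> x \<in> U \<longleftrightarrow> x \<in> U"
    and V: "openin (path_topology F) V" "V \<noteq> {}"
  shows "U \<inter> V \<noteq> {}"
proof -
  \<comment> \<open>Through index \<open>n\<close> the path follows \<open>x\<close>; index
    \<open>Suc n\<close> is the step into \<open>w\<close>, so the loops start only after
    it.\<close>
  have divert: "\<exists>z\<in>cylinder F x n. \<forall>i>Suc n. z i = Edge i w w 0" if x: "x \<in> path_space F" for x n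
  proof -
    obtain v where v: "rng (x n) = Vertex (Suc n) v" using x path_rngE by metis
    let ?s = "stay w 0" and ?e = "Edge (Suc n) v w 0"
    have s: "?s \<in> path_space F" using diag by (rule stay_path)
    have e: "?e \<in> in_edges F (rng (?s (Suc n)))" using reach by (auto simp: in_edges_iff)
    obtain y where y: "y \<in> path_space F" "y (Suc n) = ?e" "\<forall>i>Suc n. y i = ?s i"
      using ex_path_through_edge[OF diag s e] by blast
    have "rng (x n) = rng (y n)" using path_link[OF y(1), of n] y(2) v by simp
    then have "path_splice x n y \<in> path_space F" using path_splice_in x y(1) by blast
    with y(3) show ?thesis
      by (intro bexI[of _ "path_splice x n y"]) (auto simp: cylinder_def path_splice_def stay_def split: nat.split)
  qed
  obtain x y where "x \<in> U" "y \<in> V" using U V by blast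
  then have xy: "x \<in> path_space F" "y \<in> path_space F"
    using openin_subset[OF U(1)] openin_subset[OF V(1)] by auto
  obtain m n where m: "cylinder F x m \<subseteq> U" and n: "cylinder F y n \<subseteq> V"
    using openin_path_topologyE U(1) V(1) \<open>x \<in> U\<close> \<open>y \<in> V\<close> by metis
  obtain p where p: "p \<in> cylinder F x m" "\<forall>i>Suc m. p i = Edge i w w 0" using divert xy(1) by blast
  obtain q where q: "q \<in> cylinder F y n" "\<forall>i>Suc n. q i = Edge i w w 0" using divert xy(2) by blast
  have "p \<in> path_space F" "q \<in> path_space F" using p(1) q(1) by (auto simp: cylinder_def)
  moreover have "\<forall>i\<ge>Suc (Suc (max m n)). p i = q i" using p(2) q(2) by auto
  ultimately have "p \<in> U \<longleftrightarrow> q \<in> U"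
    using tail_equivalent_saturated[OF diag ord vm U_inv] by blast
  then show ?thesis using p(1) q(1) m n by blast
qed

section \<open>The two given diagrams\<close>

theorem proposition5p1:
  fixes F\<^sub>1 :: "nat^2^2" and F\<^sub>2 :: "nat^3^3"
    and \<phi>\<^sub>1 :: "2 path \<Rightarrow> 2 path" and \<phi>\<^sub>2 :: "3 path \<Rightarrow> 3 path"
  assumes F\<^sub>1: "F\<^sub>1 = vector [vector [2, 0],
                           vector [1, 2]]"
    and F\<^sub>2: "F\<^sub>2 = vector [vector [2, 1, 0],
                         vector [0, 2, 0],
                         vector [0, 1, 2]]"
    and \<phi>\<^sub>1: "vershik_map F\<^sub>1 \<phi>\<^sub>1"
    and \<phi>\<^sub>2: "vershik_map F\<^sub>2 \<phi>\<^sub>2"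
  shows "\<not> orbit_equivalent (path_topology F\<^sub>1) \<phi>\<^sub>1 (path_topology F\<^sub>2) \<phi>\<^sub>2"
proof
  assume "orbit_equivalent (path_topology F\<^sub>1) \<phi>\<^sub>1 (path_topology F\<^sub>2) \<phi>\<^sub>2"
  then obtain f where hom: "homeomorphic_map (path_topology F\<^sub>1) (path_topology F\<^sub>2) f"
    and orb: "\<And>x. x \<in> path_space F\<^sub>1 \<Longrightarrow>
      f ` full_orbit (path_space F\<^sub>1) \<phi>\<^sub>1 x = full_orbit (path_space F\<^sub>2) \<phi>\<^sub>2 (f x)"
    by (auto simp: orbit_equivalent_def)
  obtain \<omega>\<^sub>1 where o1: "bratteli_ordering F\<^sub>1 \<omega>\<^sub>1" "vershik_map_wrt F\<^sub>1 \<omega>\<^sub>1 \<phi>\<^sub>1"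
    using \<phi>\<^sub>1 by (auto simp: vershik_map_def)
  obtain \<omega>\<^sub>2 where o2: "bratteli_ordering F\<^sub>2 \<omega>\<^sub>2" "vershik_map_wrt F\<^sub>2 \<omega>\<^sub>2 \<phi>\<^sub>2"
    using \<phi>\<^sub>2 by (auto simp: vershik_map_def)
  \<comment> \<open>Row 2 of \<open>F\<^sub>1\<close> is (1, 2), so vertex 2 can be entered from
    both vertices.\<close>
  have diag1: "F\<^sub>1 $ v $ v > 0" and reach1: "F\<^sub>1 $ 2 $ v > 0" for v
    using exhaust_2[of v] by (auto simp: F\<^sub>1)
  have diag2: "F\<^sub>2 $ v $ v \<ge> 2" for v
    using exhaust_3[of v] by (auto simp: F\<^sub>2)
  \<comment> \<open>Columns 1 and 3 of \<open>F\<^sub>2\<close> vanish off the diagonal.\<close>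
  have absorb: "v \<noteq> w \<Longrightarrow> F\<^sub>2 $ v $ w = 0" if "w \<in> {1, 3}" for v w :: 3
    using exhaust_3[of v] that by (auto simp: F\<^sub>2)
  have f_onto: "f ` path_space F\<^sub>1 = path_space F\<^sub>2"
    using homeomorphic_imp_surjective_map[OF hom] by simp
  define U where "U w = {x \<in> path_space F\<^sub>1. f x \<in> path_space F\<^sub>2 - avoiding F\<^sub>2 w}" for w
  have op: "openin (path_topology F\<^sub>1) (U w)" for w
    using homeomorphic_imp_continuous_map[OF hom] openin_not_avoiding[of F\<^sub>2 w]
    by (auto simp: continuous_map_def U_def)
  have ne: "U w \<noteq> {}" for w
  proof -
    \<comment> \<open>The path looping at \<open>w\<close> visits \<open>w\<close>, and surjectivity
      of \<open>f\<close> supplies a preimage.\<close>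
    have "stay w 0 \<in> path_space F\<^sub>2 - avoiding F\<^sub>2 w"
      using stay_path[of 0 F\<^sub>2 w] diag2[of w] by (auto simp: avoiding_def)
    then obtain x where "x \<in> path_space F\<^sub>1" "stay w 0 = f x" using f_onto by blast
    then show ?thesis using \<open>stay w 0 \<in> _\<close> by (auto simp: U_def)
  qed
  have inv: "\<phi>\<^sub>1 x \<in> U 1 \<longleftrightarrow> x \<in> U 1" if x: "x \<in> path_space F\<^sub>1" for x
  proof -
    have "f x \<in> path_space F\<^sub>2" "f (\<phi>\<^sub>1 x) \<in> path_space F\<^sub>2"
      using x vershik_map_path[OF o1(2) x] f_onto by auto
    moreover have "f (\<phi>\<^sub>1 x) \<in> avoiding F\<^sub>2 1 \<longleftrightarrow> f x \<in> avoiding F\<^sub>2 1"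
      by (rule orbit_equivalence_pullback_invariant[where f = f, OF orb[OF x] \<open>f x \<in> _\<close> vershik_map_image[OF o2(2)]])
        (rule avoiding_invariant[OF diag2 absorb o2], auto)
    ultimately show ?thesis using x vershik_map_path[OF o1(2) x] by (simp add: U_def)
  qed
  \<comment> \<open>Transitivity of \<open>\<phi>\<^sub>1\<close>, with vertex 2 in the role of
    \<open>w\<close>.\<close>
  have "U 1 \<inter> U 3 \<noteq> {}"
    by (rule vershik_map_transitive[OF diag1 reach1 o1 op ne inv op ne])
  then obtain z where z: "z \<in> path_space F\<^sub>2" "z \<notin> avoiding F\<^sub>2 1" "z \<notin> avoiding F\<^sub>2 3"
    by (auto simp: U_def)
  then obtain i j where ij: "rng (z i) = Vertex (Suc i) 1" "rng (z j) = Vertex (Suc j) 3"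
    by (auto simp: avoiding_def)
  \<comment> \<open>By absorption, at the later of the two visits \<open>z\<close> would be at
    vertices 1 and 3 at once.\<close>
  have "rng (z (max i j)) = Vertex (Suc (max i j)) 1"
    by (rule absorbing_stays[OF absorb z(1) ij(1)]) auto
  moreover have "rng (z (max i j)) = Vertex (Suc (max i j)) 3"
    by (rule absorbing_stays[OF absorb z(1) ij(2)]) auto
  ultimately show False by simp
qed

end
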